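(* Let $\boldsymbol{B}_1,\dots,\boldsymbol{B}_n\in\mathbb{R}^{K+p+1}$ be as defined in the context and, for subsampling probabilities $(\pi_1,\dots,\pi_n)$ with $\sum_{i=1}^n\pi_i=1$, let $$\boldsymbol{V}_\pi=\frac1{n^2}\sum_{i=1}^n\frac{\boldsymbol{B}_i\boldsymbol{B}_i^T}{\pi_i}.$$ If the subsampling probabilities $\pi_i$, $i=1,\dots,n$, are chosen as $$\pi_i^{FLopt}=\frac{\Vert\boldsymbol{B}_i\Vert_2}{\sum_{j=1}^n\Vert\boldsymbol{B}_j\Vert_2},$$ then $\mathrm{tr}(\boldsymbol{V}_\pi)$ attains its minimum among all subsampling probabilities $(\pi_1,\dots,\pi_n)$ with $\sum_{i=1}^n\pi_i=1$.
   Context: $x_1,\dots,x_n\in L^2[0,1]$ are (non-random) functional covariates, $\boldsymbol{B}(t)=(B_1(t),\dots,B_{K+p+1}(t))^T$ is the vector of normalized B-spline basis functions of degree $p$ with $K$ equispaced interior knots on $[0,1]$, and $\boldsymbol{B}_i=\int_0^1x_i(t)\boldsymbol{B}(t)\,\mathrm{d}t$. The $\pi_i$ are the probabilities with which the data points are drawn (with replacement) into a subsample. $\Vert\cdot\Vert_2$ is the Euclidean norm. *)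

theory Defs
  imports "HOL-Analysis.Analysis"
begin

text \<open>
  Clamped knot sequence on [0,1], numbered from 1: \<open>p + 1\<close> knots at 0, the \<open>K\<close> equispaced interior
  knots \<open>m / (K + 1)\<close>, and \<open>p + 1\<close> knots at 1.
\<close>

definition knot :: "nat \<Rightarrow> nat \<Rightarrow> nat \<Rightarrow> real" where
  "knot K p j = min 1 (max 0 ((real j - real (p + 1)) / real (K + 1)))"

text \<open>
  Cox--de Boor recursion in the normalization where the basis functions sum to 1 on [0,1].
  The usual convention \<open>0 / 0 = 0\<close> at coincident knots agrees with \<open>x / 0 = 0\<close> in HOL. The knot
  intervals are half-open, except that the last nondegenerate one contains its right endpoint 1.
\<close>

fun bspline :: "(nat \<Rightarrow> real) \<Rightarrow> nat \<Rightarrow> nat \<Rightarrow> real \<Rightarrow> real" where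
  "bspline \<kappa> 0 j t =
     (if \<kappa> j \<le> t \<and> t < \<kappa> (j + 1) \<or> t = 1 \<and> \<kappa> j < 1 \<and> \<kappa> (j + 1) = 1 then 1 else 0)"
| "bspline \<kappa> (Suc d) j t =
     (t - \<kappa> j) / (\<kappa> (j + d + 1) - \<kappa> j) * bspline \<kappa> d j t
     + (\<kappa> (j + d + 2) - t) / (\<kappa> (j + d + 2) - \<kappa> (j + 1)) * bspline \<kappa> d (j + 1) t"

text \<open>
  The coordinates of \<open>real ^ 'd\<close> are numbered by a bijection \<open>ix\<close> from \<open>'d\<close> onto \<open>{1..K + p + 1}\<close>.
\<close>

definition spline_vec :: "('d::finite \<Rightarrow> nat) \<Rightarrow> nat \<Rightarrow> nat \<Rightarrow> real \<Rightarrow> real ^ 'd" where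
  "spline_vec ix K p t = (\<chi> j. bspline (knot K p) p (ix j) t)"

definition L2_unit :: "(real \<Rightarrow> real) set" where
  "L2_unit = {f. f \<in> borel_measurable (lebesgue_on {0..1}) \<and>
                 integrable (lebesgue_on {0..1}) (\<lambda>t. (f t)\<^sup>2)}"

definition Bvec :: "('d::finite \<Rightarrow> nat) \<Rightarrow> nat \<Rightarrow> nat \<Rightarrow> (real \<Rightarrow> real) \<Rightarrow> real ^ 'd" where
  "Bvec ix K p f = (LINT t|lebesgue_on {0..1}. f t *\<^sub>R spline_vec ix K p t)"

definition V_mat :: "nat \<Rightarrow> (nat \<Rightarrow> real ^ 'd) \<Rightarrow> (nat \<Rightarrow> real) \<Rightarrow> real ^ 'd ^ 'd" where
  "V_mat n B \<pi> =
     (1 / (real n)\<^sup>2) *\<^sub>R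
       (\<Sum>i=1..n. (1 / \<pi> i) *\<^sub>R ((columnvector (B i) :: real ^ 1 ^ 'd) ** rowvector (B i)))"

text \<open>
  The probabilities for which \<open>V_mat\<close> is meaningful. A zero probability is allowed only where
  \<open>B i = 0\<close>, so that the summand is 0 by the convention \<open>0 / 0 = 0\<close>. With \<open>\<pi> i = 0\<close> and
  \<open>B i \<noteq> 0\<close> the summand is undefined (its trace is infinite), whereas \<open>1 / 0 = 0\<close> in HOL would
  silently drop it.
\<close>

definition subsampling_probs :: "nat \<Rightarrow> (nat \<Rightarrow> real ^ 'd) \<Rightarrow> (nat \<Rightarrow> real) \<Rightarrow> bool" where
  "subsampling_probs n B \<pi> \<longleftrightarrow>
     (\<forall>i\<in>{1..n}. \<pi> i \<ge> 0 \<and> (B i \<noteq> 0 \<longrightarrow> \<pi> i > 0)) \<and> (\<Sum>i=1..n. \<pi> i) = 1"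

definition pi_FLopt :: "nat \<Rightarrow> (nat \<Rightarrow> real ^ 'd) \<Rightarrow> nat \<Rightarrow> real" where
  "pi_FLopt n B i = norm (B i) / (\<Sum>j=1..n. norm (B j))"

end

theory Submission imports Defs begin

text \<open>
  The trace of \<open>V_mat n B \<pi>\<close> is \<open>1/n\<^sup>2\<close> times the sum of the \<open>b\<^sub>i\<^sup>2 / \<pi>\<^sub>i\<close> with \<open>b\<^sub>i = \<parallel>B\<^sub>i\<parallel>\<close>. With \<open>S\<close> the sum of
  the \<open>b\<^sub>i\<close>, each summand lies above its tangent, \<open>b\<^sub>i\<^sup>2 / \<pi>\<^sub>i \<ge> 2 S b\<^sub>i - S\<^sup>2 \<pi>\<^sub>i\<close>, with equality for
  \<open>\<pi>\<^sub>i = b\<^sub>i / S\<close>; summing over \<open>i\<close> gives the lower bound \<open>S\<^sup>2\<close>.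
\<close>

lemma trace_scaleR: "trace (c *\<^sub>R A) = c * trace (A :: real ^ 'd ^ 'd)"
  by (simp add: trace_def sum_distrib_left)

lemma trace_sum: "trace (\<Sum>i\<in>I. A i) = (\<Sum>i\<in>I. trace (A i :: real ^ 'd ^ 'd))"
  unfolding trace_def sum_component by (rule sum.swap)

lemma trace_columnvector_rowvector:
  fixes v :: "real ^ 'd"
  shows "trace ((columnvector v :: real ^ 1 ^ 'd) ** rowvector v) = (norm v)\<^sup>2"
  by (simp add: trace_def matrix_matrix_mult_def columnvector_def rowvector_def
      power2_norm_eq_inner inner_vec_def)

lemma trace_V_mat: "trace (V_mat n B \<pi>) = (\<Sum>i=1..n. (norm (B i))\<^sup>2 / \<pi> i) / (real n)\<^sup>2"
  by (simp add: V_mat_def trace_scaleR trace_sum trace_columnvector_rowvector)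

text \<open>For \<open>q > 0\<close>, multiplying by \<open>q\<close> turns the claim into
  \<open>(b - s * q)\<^sup>2 \<ge> 0\<close>.\<close>

lemma square_divide_ge_tangent:
  fixes b q s :: real
  assumes "q \<ge> 0" "b \<noteq> 0 \<Longrightarrow> q > 0"
  shows "2 * s * b - s\<^sup>2 * q \<le> b\<^sup>2 / q"
proof (cases "b = 0")
  case True
  \<comment> \<open>Here \<open>q\<close> may be 0; the right side is 0 in any case, by
    \<open>0 / 0 = 0\<close> if need be.\<close>
  then show ?thesis using assms by simp
next
  case False
  then have "q > 0" using assms by simp
  moreover have "(2 * s * b - s\<^sup>2 * q) * q \<le> b\<^sup>2"
    using zero_le_power2[of "b - s * q"] by (simp add: power2_eq_square algebra_simps)
  ultimately show ?thesis
    by (simp only: pos_le_divide_eq)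
qed

lemma sum_norm_pos:
  fixes B :: "nat \<Rightarrow> 'a::real_normed_vector"
  assumes "\<exists>i\<in>{1..n}. B i \<noteq> 0"
  shows "(\<Sum>i=1..n. norm (B i)) > 0"
proof -
  obtain i where "i \<in> {1..n}" "B i \<noteq> 0" using assms by blast
  then show ?thesis by (intro sum_pos2[of _ i]) auto
qed

text \<open>A nonzero \<open>B i\<close> makes the normalizing sum positive; if all vanished,
  \<open>0 / 0 = 0\<close> would give total mass 0 instead of 1.\<close>

lemma subsampling_probs_pi_FLopt:
  assumes "\<exists>i\<in>{1..n}. B i \<noteq> 0"
  shows "subsampling_probs n B (pi_FLopt n B)"
  using sum_norm_pos[OF assms]
  by (simp add: subsampling_probs_def pi_FLopt_def flip: sum_divide_distrib)

lemma trace_V_mat_ge: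
  assumes "subsampling_probs n B \<pi>"
  shows "(\<Sum>i=1..n. norm (B i))\<^sup>2 / (real n)\<^sup>2 \<le> trace (V_mat n B \<pi>)"
proof -
  define S where "S = (\<Sum>i=1..n. norm (B i))"
  \<comment> \<open>The constraint that the \<open>\<pi> i\<close> sum to 1 enters here.\<close>
  have "S\<^sup>2 = 2 * S * (\<Sum>i=1..n. norm (B i)) - S\<^sup>2 * (\<Sum>i=1..n. \<pi> i)"
    using assms by (simp add: subsampling_probs_def S_def power2_eq_square)
  also have "\<dots> = (\<Sum>i=1..n. 2 * S * norm (B i) - S\<^sup>2 * \<pi> i)"
    by (simp add: sum_subtractf sum_distrib_left)
  also have "\<dots> \<le> (\<Sum>i=1..n. (norm (B i))\<^sup>2 / \<pi> i)"
    using assms by (intro sum_mono square_divide_ge_tangent) (auto simp: subsampling_probs_def)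
  finally show ?thesis
    unfolding trace_V_mat S_def by (rule divide_right_mono) simp
qed

lemma trace_V_mat_pi_FLopt:
  "trace (V_mat n B (pi_FLopt n B)) = (\<Sum>i=1..n. norm (B i))\<^sup>2 / (real n)\<^sup>2"
proof -
  define S where "S = (\<Sum>i=1..n. norm (B i))"
  have "(\<Sum>i=1..n. (norm (B i))\<^sup>2 / pi_FLopt n B i) = (\<Sum>i=1..n. S * norm (B i))"
    \<comment> \<open>If \<open>B i = 0\<close>, both summands are 0, the left one as
      \<open>0 / 0\<close>; otherwise \<open>norm (B i)\<close> cancels once.\<close>
    by (intro sum.cong) (auto simp: pi_FLopt_def S_def power2_eq_square)
  also have "\<dots> = S\<^sup>2"
    by (simp add: S_def power2_eq_square flip: sum_distrib_left)
  finally show ?thesis by (simp add: trace_V_mat S_def)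
qed

theorem theorem5:
  fixes n K p :: nat
    and ix :: "'d::finite \<Rightarrow> nat"
    and x :: "nat \<Rightarrow> real \<Rightarrow> real"
    and B :: "nat \<Rightarrow> real ^ 'd"
  assumes ix: "bij_betw ix UNIV {1..K + p + 1}"
    and x_L2: "\<And>i. i \<in> {1..n} \<Longrightarrow> x i \<in> L2_unit"
    and B_eq: "\<And>i. i \<in> {1..n} \<Longrightarrow> B i = Bvec ix K p (x i)"
    and nonzero: "\<exists>i\<in>{1..n}. B i \<noteq> 0"
  shows "is_arg_min (\<lambda>\<pi>. trace (V_mat n B \<pi>)) (subsampling_probs n B) (pi_FLopt n B)"
  using subsampling_probs_pi_FLopt[OF nonzero] trace_V_mat_ge[of n B]
  by (auto simp: is_arg_min_def trace_V_mat_pi_FLopt not_less)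

end
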